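(* Assume that $\mathbf{R}:\mathbb{R}^N\to\mathbb{R}^m$ is continuously differentiable and that its Jacobian $\mathbf{J}$ is $L$-Lipschitz continuous on $\mathbb{R}^N$, i.e. $\|\mathbf{J}(\mathbf{x})-\mathbf{J}(\mathbf{y})\|\le L\|\mathbf{x}-\mathbf{y}\|$ for all $\mathbf{x},\mathbf{y}\in\mathbb{R}^N$. Let $\{\mathbf{x}^k\}$ be a sequence generated by the LMS algorithm (described in the context) from an arbitrary $\mathbf{x}^0\in\mathbb{R}^N$, and assume $\ell_{\min}>0$. Then every accumulation point of $\{\mathbf{x}^k\}$ is a stationary point of $\mathbf{F}$, i.e. a point $\bar{\mathbf{x}}$ with $\mathbf{J}(\bar{\mathbf{x}})^\top\mathbf{R}(\bar{\mathbf{x}})=0$.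
   Context: Norms are Euclidean (spectral for matrices). $\mathbf{R}:\mathbb{R}^N\to\mathbb{R}^m$ is the residual vector, $\mathbf{J}(\mathbf{x})\in\mathbb{R}^{m\times N}$ its Jacobian, $\mathbf{F}(\mathbf{x})=\frac12\|\mathbf{R}(\mathbf{x})\|^2$, and $\mathbf{g}(\mathbf{x})=\mathbf{J}(\mathbf{x})^\top\mathbf{R}(\mathbf{x})$ is the gradient of $\mathbf{F}$. A partition $I_1,\dots,I_K$ of the variable indices $\{1,\dots,N\}$ is fixed. $\mathbf{H}(\mathbf{x})$ is the block diagonal part of $\mathbf{J}(\mathbf{x})^\top\mathbf{J}(\mathbf{x})$ with respect to this partition (entries $(i,j)$ with $i,j$ in the same $I_s$ are kept, all others are set to zero), and $\mathbf{B}(\mathbf{x})=\mathbf{J}(\mathbf{x})^\top\mathbf{J}(\mathbf{x})-\mathbf{H}(\mathbf{x})$. A subscript or superscript $k$ denotes evaluation at $\mathbf{x}^k$: $\mathbf{R}_k,\mathbf{J}_k,\mathbf{H}_k,\mathbf{B}_k,\mathbf{g}^k$. LMS algorithm. Parameters: $c\in(0,1)$, $b\in(0,1)$, $\eta\in[0,1)$, $0\le\ell_{\min}<\ell_0$; starting point $\mathbf{x}^0$. Iteration $k\ge 0$: 1. Set $\mu_k=1+\frac{(1+b)^2}{1-b}\max_{i=0,1,2,3}\hat a_i^k$, where $\hat a_0^k=\frac{\ell_k^2}{4}\|\mathbf{H}_k\|\|\mathbf{J}_k\|\|\mathbf{R}_k\|$, $\hat a_1^k=\frac{\ell_k^2}{4}\|\mathbf{J}_k\|\|\mathbf{R}_k\|+\ell_k\|\mathbf{H}_k\|\|\mathbf{J}_k\|^2\|\mathbf{R}_k\|$,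 $\hat a_2^k=\|\mathbf{H}_k\|\|\mathbf{J}_k\|^2+\ell_k\|\mathbf{H}_k\|\|\mathbf{R}_k\|+\ell_k\|\mathbf{J}_k\|^2\|\mathbf{R}_k\|$, $\hat a_3^k=\|\mathbf{J}_k\|^2+\ell_k\|\mathbf{R}_k\|$. 2. Choose any $\beta_k\in\mathbb{R}$ with $\|\beta_k\mathbf{B}_k\|\le\frac{b\mu_k}{\|\mathbf{H}_k\|+\mu_k}$. 3. Set $\gamma_k=\|\mathbf{I}-\beta_k\mathbf{B}_k\|$. 4. Let $\mathbf{d}^k$ solve $(\mathbf{H}_k+\mu_k\mathbf{I})\mathbf{d}^k=(\beta_k\mathbf{B}_k-\mathbf{I})\mathbf{g}^k$. 5. Let $t_k$ be the largest positive $t\le\min\{1,1/\gamma_k\}$ such that $\mathbf{F}(\mathbf{x}^k+t\mathbf{d}^k)\le\mathbf{F}(\mathbf{x}^k)+ct(\mathbf{d}^k)^\top\mathbf{g}^k$. 6. Set $\mathbf{x}^{k+1}=\mathbf{x}^k+t_k\mathbf{d}^k$. 7. If $t_k<\min\{1,1/\gamma_k\}$, set $\ell_{k+1}=2\ell_k$. Otherwise let $A_k=\mathbf{F}(\mathbf{x}^{k+1})-\mathbf{F}(\mathbf{x}^k)$ and $P_k=\mathbf{F}(\mathbf{x}^k)-\|\mathbf{R}_k+\mathbf{J}_k\mathbf{d}^k\|^2-\mu_k\|\mathbf{d}^k\|^2$; set $\ell_{k+1}=\max\{\ell_{\min},\ell_k/2\}$ if $A_k>\eta P_k$, and $\ell_{k+1}=\ell_k$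 otherwise. *)

theory Defs
  imports "HOL-Analysis.Analysis"
begin

(* The library norm on real^'n^'m is the Frobenius norm, so the spectral norm,
   i.e. the operator norm for Euclidean vector norms, is introduced separately. *)
definition spectral_norm :: "real^'n^'m \<Rightarrow> real" where
  "spectral_norm A = onorm ((*v) A)"

definition block_diag_part :: "'n set set \<Rightarrow> real^'n^'n \<Rightarrow> real^'n^'n" where
  "block_diag_part P A = (\<chi> i j. if \<exists>I\<in>P. i \<in> I \<and> j \<in> I then A $ i $ j else 0)"

definition least_squares :: "(real^'n \<Rightarrow> real^'m) \<Rightarrow> real^'n \<Rightarrow> real" where
  "least_squares R x = (1 / 2) * (norm (R x))\<^sup>2"

(* The arguments h, j, r stand for the norms of H_k, J_k and R_k. *)
definition lms_mu :: "real \<Rightarrow> real \<Rightarrow> real \<Rightarrow> real \<Rightarrow> real \<Rightarrow> real" where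
  "lms_mu b l h j r = 1 + (1 + b)\<^sup>2 / (1 - b) *
     Max {l\<^sup>2 / 4 * h * j * r,
          l\<^sup>2 / 4 * j * r + l * h * j\<^sup>2 * r,
          h * j\<^sup>2 + l * h * r + l * j\<^sup>2 * r,
          j\<^sup>2 + l * r}"

(* One iteration, as a relation between (x, l) = (x^k, l_k) and
   (x', l') = (x^(k+1), l_(k+1)): beta may be any admissible number, so
   the successor is not determined by the current state. *)
definition lms_step ::
  "(real^'n \<Rightarrow> real^'m) \<Rightarrow> (real^'n \<Rightarrow> real^'n^'m) \<Rightarrow> 'n set set \<Rightarrow>
   real \<Rightarrow> real \<Rightarrow> real \<Rightarrow> real \<Rightarrow> real^'n \<Rightarrow> real \<Rightarrow> real^'n \<Rightarrow> real \<Rightarrow> bool" where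
  "lms_step R J P c b \<eta> lmin x l x' l' \<longleftrightarrow>
    (let F = least_squares R;
         g = transpose (J x) *v R x;
         H = block_diag_part P (transpose (J x) ** J x);
         B = transpose (J x) ** J x - H;
         \<mu> = lms_mu b l (spectral_norm H) (spectral_norm (J x)) (norm (R x))
     in \<exists>\<beta> d t.
        spectral_norm (\<beta> *\<^sub>R B) \<le> b * \<mu> / (spectral_norm H + \<mu>) \<and>
        (H + \<mu> *\<^sub>R mat 1) *v d = (\<beta> *\<^sub>R B - mat 1) *v g \<and>
        (let \<gamma> = spectral_norm (mat 1 - \<beta> *\<^sub>R B);
             tmax = min 1 (1 / \<gamma>);
             T = {s. 0 < s \<and> s \<le> tmax \<and> F (x + s *\<^sub>R d) \<le> F x + c * s * (d \<bullet> g)};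
             ared = F x' - F x;
             pred = F x - (norm (R x + J x *v d))\<^sup>2 - \<mu> * (norm d)\<^sup>2
         in t \<in> T \<and> (\<forall>s\<in>T. s \<le> t) \<and>
            x' = x + t *\<^sub>R d \<and>
            l' = (if t < tmax then 2 * l
                  else if ared > \<eta> * pred then max lmin (l / 2)
                  else l)))"

definition lms_sequence ::
  "(real^'n \<Rightarrow> real^'m) \<Rightarrow> (real^'n \<Rightarrow> real^'n^'m) \<Rightarrow> 'n set set \<Rightarrow>
   real \<Rightarrow> real \<Rightarrow> real \<Rightarrow> real \<Rightarrow> real \<Rightarrow> real^'n \<Rightarrow> (nat \<Rightarrow> real^'n) \<Rightarrow> bool" where
  "lms_sequence R J P c b \<eta> lmin l0 x0 x \<longleftrightarrow>
    (\<exists>l. x 0 = x0 \<and> l 0 = l0 \<and>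
      (\<forall>k. lms_step R J P c b \<eta> lmin (x k) (l k) (x (Suc k)) (l (Suc k))))"

(* A cluster point of the sequence, not a limit point of its range: the two
   differ for sequences that repeat values. *)
definition accumulation_point :: "(nat \<Rightarrow> 'a::topological_space) \<Rightarrow> 'a \<Rightarrow> bool" where
  "accumulation_point x a \<longleftrightarrow> (\<exists>r. strict_mono r \<and> (x \<circ> r) \<longlonglongrightarrow> a)"

end

theory Submission
  imports Defs
begin

text \<open>
  Write j, h, r for the norms of J, H, R at an iterate and N for the number of variables.
  The direction satisfies d . g \<le> - (1 - b) |g|^2 / (h + \<mu>) and |d| \<le> 2 |g| / \<mu>, and a step s \<le> 1
  is accepted as soon as s times K (j^2 / (2 \<mu>) + 3 L / l + 2 (L / l)^2) is at most 1, with K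
  depending only on N, b, c. As \<mu> \<ge> j^2 and l \<ge> lmin, the accepted step lengths are bounded below.
  If R vanishes at the accumulation point there is nothing to prove; otherwise r stays away from 0
  by monotonicity. Then (j^2 / \<mu>)^2 \<le> N^2 / \<mu> is at most a constant over l, because j^2 \<le> N^2 h,
  h j^2 \<le> \<mu> and l r \<le> \<mu>, so the full step is accepted once l is large, whatever c < 1 is. Hence l is
  bounded, so \<mu> is bounded along the convergent subsequence, and since the decreases of F tend
  to 0, so does g.
\<close>

section \<open>Spectral norm and transpose\<close>

lemma norm_matrix_vector_le: "norm (A *v v) \<le> spectral_norm A * norm v"
  unfolding spectral_norm_def by (rule onorm) (rule matrix_vector_mul_bounded_linear)

lemma spectral_norm_le: "(\<And>v. norm (A *v v) \<le> K * norm v) \<Longrightarrow> spectral_norm A \<le> K"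
  unfolding spectral_norm_def by (rule onorm_le)

lemma spectral_norm_nonneg: "0 \<le> spectral_norm A"
  unfolding spectral_norm_def by (rule onorm_pos_le) (rule matrix_vector_mul_bounded_linear)

lemma inner_transpose_mult: "(transpose A *v u) \<bullet> v = u \<bullet> (A *v v)" for A :: "real^'n^'m"
  by (simp add: dot_lmul_matrix transpose_matrix_vector)

text \<open>Pairing \<open>transpose A *v u\<close> with itself moves the transpose to the other
  factor; Cauchy-Schwarz and cancelling one factor of the norm then give the bound.\<close>

lemma norm_transpose_mult_le: "norm (transpose A *v u) \<le> spectral_norm A * norm u"
  for A :: "real^'n^'m"
proof -
  let ?w = "transpose A *v u"
  have "(norm ?w)\<^sup>2 = u \<bullet> (A *v ?w)"
    by (simp only: power2_norm_eq_inner inner_transpose_mult)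
  also have "\<dots> \<le> norm u * (spectral_norm A * norm ?w)"
    by (meson norm_cauchy_schwarz norm_matrix_vector_le mult_left_mono norm_ge_zero order_trans)
  finally have "norm ?w * norm ?w \<le> norm ?w * (spectral_norm A * norm u)"
    by (simp add: power2_eq_square mult_ac)
  then show ?thesis
    by (cases "norm ?w = 0") (auto simp: spectral_norm_nonneg)
qed

section \<open>Block diagonal part of a Gram matrix\<close>

lemma inner_matrix_vector: "u \<bullet> (A *v v) = (\<Sum>i\<in>UNIV. \<Sum>j\<in>UNIV. u $ i * A $ i $ j * v $ j)"
  for A :: "real^'n^'n"
  by (simp add: inner_vec_def matrix_vector_mult_def sum_distrib_left mult_ac)

lemma transpose_mult_entry: "(transpose A ** A) $ i $ j = column i A \<bullet> column j A"
  for A :: "real^'n^'m"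
  by (simp add: matrix_matrix_mult_def transpose_def column_def inner_vec_def)

lemma norm_column_le: "norm (column i A) \<le> spectral_norm A" for A :: "real^'n^'m"
  using norm_matrix_vector_le[of A "axis i 1"] by (simp add: matrix_vector_mult_basis)

text \<open>Since blocks are disjoint, \<open>I\<close> is the only block containing
  \<open>i\<close>, so the existential in the definition collapses to membership in
  \<open>I\<close>.\<close>

lemma block_diag_part_row:
  assumes "partition_on UNIV P" "I \<in> P" "i \<in> I"
  shows "block_diag_part P A $ i $ j = (if j \<in> I then A $ i $ j else 0)"
proof -
  have "(\<exists>I\<in>P. i \<in> I \<and> j \<in> I) \<longleftrightarrow> j \<in> I"
    using assms unfolding partition_on_def disjoint_def by blast
  then show ?thesis by (simp add: block_diag_part_def)
qed

lemma block_diag_part_diag: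
  assumes "partition_on UNIV P"
  shows "block_diag_part P A $ i $ i = A $ i $ i"
proof -
  obtain I where "I \<in> P" "i \<in> I"
    using assms unfolding partition_on_def by blast
  then show ?thesis using block_diag_part_row[OF assms] by simp
qed

lemma block_diag_part_symmetric:
  assumes "\<And>i j. A $ i $ j = A $ j $ i"
  shows "u \<bullet> (block_diag_part P A *v v) = v \<bullet> (block_diag_part P A *v u)"
  unfolding inner_matrix_vector
  by (subst sum.swap) (auto intro!: sum.cong simp: block_diag_part_def assms)

text \<open>The quadratic form splits over the blocks. On a block \<open>I\<close> it is the squared
  length of the combination of the columns of \<open>A\<close> with indices in \<open>I\<close>,
  weighted by \<open>v\<close>.\<close>

lemma block_diag_part_gram_psd:
  fixes A :: "real^'n^'m"
  assumes P: "partition_on UNIV P"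
  shows "0 \<le> v \<bullet> (block_diag_part P (transpose A ** A) *v v)"
proof -
  let ?H = "block_diag_part P (transpose A ** A)"
  let ?f = "\<lambda>i. \<Sum>j\<in>UNIV. v $ i * ?H $ i $ j * v $ j"
  define w where "w I = (\<Sum>i\<in>I. v $ i *\<^sub>R column i A)" for I
  have block: "(\<Sum>i\<in>I. ?f i) = w I \<bullet> w I" if I: "I \<in> P" for I
  proof -
    have "?f i = (\<Sum>j\<in>I. (v $ i *\<^sub>R column i A) \<bullet> (v $ j *\<^sub>R column j A))"
      if "i \<in> I" for i
    proof -
      have "?f i = (\<Sum>j\<in>UNIV. if j \<in> I then v $ i * (transpose A ** A) $ i $ j * v $ j else 0)"
        using block_diag_part_row[OF P I that] by (auto intro!: sum.cong)
      then show ?thesis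
        by (simp add: sum.If_cases transpose_mult_entry mult_ac)
    qed
    then have "(\<Sum>i\<in>I. ?f i)
        = (\<Sum>i\<in>I. \<Sum>j\<in>I. (v $ i *\<^sub>R column i A) \<bullet> (v $ j *\<^sub>R column j A))"
      by (rule sum.cong[OF refl])
    then show ?thesis
      by (simp only: w_def inner_sum_left inner_sum_right) (rule sum.swap)
  qed
  have "v \<bullet> (?H *v v) = (\<Sum>i\<in>\<Union>P. ?f i)"
    using P by (simp add: inner_matrix_vector partition_on_def)
  also have "\<dots> = (\<Sum>I\<in>P. \<Sum>i\<in>I. ?f i)"
    using P by (subst sum.Union_disjoint) (auto simp: partition_on_def disjoint_def)
  also have "\<dots> = (\<Sum>I\<in>P. w I \<bullet> w I)"
    by (intro sum.cong) (auto simp: block)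
  finally show ?thesis by (simp add: sum_nonneg)
qed

text \<open>Each entry is zero or an inner product of two columns of \<open>A\<close>, hence at most
  the squared spectral norm in absolute value. Summing over all entries costs the factor N^2; a
  crude constant suffices.\<close>

lemma spectral_norm_block_diag_part_gram_le:
  fixes A :: "real^'n^'m"
  shows "spectral_norm (block_diag_part P (transpose A ** A))
    \<le> (real CARD('n))\<^sup>2 * (spectral_norm A)\<^sup>2"
proof (rule spectral_norm_le)
  fix v :: "real^'n"
  let ?H = "block_diag_part P (transpose A ** A)"
  let ?j = "spectral_norm A"
  have entry: "\<bar>?H $ i $ k\<bar> \<le> ?j\<^sup>2" for i k
  proof -
    have "\<bar>?H $ i $ k\<bar> \<le> \<bar>column i A \<bullet> column k A\<bar>"
      by (simp add: block_diag_part_def transpose_mult_entry)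
    also have "\<dots> \<le> norm (column i A) * norm (column k A)"
      by (rule Cauchy_Schwarz_ineq2)
    also have "\<dots> \<le> ?j\<^sup>2"
      unfolding power2_eq_square by (intro mult_mono norm_column_le spectral_norm_nonneg norm_ge_zero)
    finally show ?thesis .
  qed
  have "norm (?H *v v) \<le> (\<Sum>i\<in>UNIV. \<bar>(?H *v v) $ i\<bar>)"
    by (rule norm_le_l1_cart)
  also have "\<dots> \<le> (\<Sum>i\<in>(UNIV::'n set). \<Sum>k\<in>(UNIV::'n set). ?j\<^sup>2 * norm v)"
  proof (intro sum_mono)
    fix i
    have "\<bar>(?H *v v) $ i\<bar> \<le> (\<Sum>k\<in>UNIV. \<bar>?H $ i $ k * v $ k\<bar>)"
      unfolding matrix_vector_mult_def by simp
    also have "\<dots> \<le> (\<Sum>k\<in>(UNIV::'n set). ?j\<^sup>2 * norm v)"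
      unfolding abs_mult
      by (intro sum_mono mult_mono entry component_le_norm_cart) auto
    finally show "\<bar>(?H *v v) $ i\<bar> \<le> (\<Sum>k\<in>(UNIV::'n set). ?j\<^sup>2 * norm v)" .
  qed
  finally show "norm (?H *v v) \<le> (real CARD('n))\<^sup>2 * ?j\<^sup>2 * norm v"
    by (simp add: power2_eq_square mult_ac)
qed

text \<open>The diagonal survives in the block diagonal part and consists of the squared column
  lengths of \<open>A\<close>. So every column has length at most the square root of the norm of
  that part, and \<open>A *v v\<close> is a combination of N columns.\<close>

lemma spectral_norm_le_block_diag_part_gram:
  fixes A :: "real^'n^'m"
  assumes P: "partition_on UNIV P"
  shows "(spectral_norm A)\<^sup>2
    \<le> (real CARD('n))\<^sup>2 * spectral_norm (block_diag_part P (transpose A ** A))"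
proof -
  let ?H = "block_diag_part P (transpose A ** A)"
  let ?h = "spectral_norm ?H"
  have col: "norm (column i A) \<le> sqrt ?h" for i
  proof -
    have "(norm (column i A))\<^sup>2 = ?H $ i $ i"
      by (simp add: block_diag_part_diag[OF P] transpose_mult_entry power2_norm_eq_inner)
    also have "\<dots> \<le> norm (column i ?H)"
      using component_le_norm_cart[of "column i ?H" i] by (simp add: column_def)
    also have "\<dots> \<le> ?h" by (rule norm_column_le)
    finally show ?thesis by (rule real_le_rsqrt)
  qed
  have "spectral_norm A \<le> real CARD('n) * sqrt ?h"
  proof (rule spectral_norm_le)
    fix v :: "real^'n"
    have "norm (A *v v) \<le> (\<Sum>i\<in>UNIV. norm (v $ i *s column i A))"
      unfolding matrix_mult_sum by (rule norm_sum)
    also have "\<dots> \<le> (\<Sum>i\<in>(UNIV::'n set). norm v * sqrt ?h)"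
      unfolding scalar_mult_eq_scaleR norm_scaleR real_norm_def[symmetric]
      by (intro sum_mono mult_mono col) (auto simp: component_le_norm_cart)
    finally show "norm (A *v v) \<le> real CARD('n) * sqrt ?h * norm v"
      by (simp add: mult_ac)
  qed
  then have "(spectral_norm A)\<^sup>2 \<le> (real CARD('n) * sqrt ?h)\<^sup>2"
    by (intro power_mono spectral_norm_nonneg)
  then show ?thesis
    by (simp add: power_mult_distrib spectral_norm_nonneg)
qed

section \<open>The search direction\<close>

text \<open>This is M^2 \<le> K M for a symmetric matrix with 0 \<le> M \<le> K, obtained without
  diagonalization by evaluating the form of M at u - (M u) / K.\<close>

lemma psd_norm_mult_le:
  fixes M :: "real^'n^'n"
  assumes sym: "\<And>u v. u \<bullet> (M *v v) = v \<bullet> (M *v u)"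
    and psd: "\<And>v. 0 \<le> v \<bullet> (M *v v)"
    and bnd: "\<And>v. v \<bullet> (M *v v) \<le> K * (norm v)\<^sup>2"
    and K: "0 < K"
  shows "(norm (M *v u))\<^sup>2 \<le> K * (u \<bullet> (M *v u))"
proof -
  let ?w = "M *v u"
  have "0 \<le> (u - (1/K) *\<^sub>R ?w) \<bullet> (M *v (u - (1/K) *\<^sub>R ?w))"
    by (rule psd)
  also have "\<dots> = u \<bullet> ?w - (2/K) * (?w \<bullet> ?w) + (1/K)\<^sup>2 * (?w \<bullet> (M *v ?w))"
    by (simp add: matrix_vector_mult_diff_distrib matrix_vector_mult_scaleR inner_diff_left
        inner_diff_right sym[of u ?w] power2_eq_square algebra_simps)
  also have "\<dots> \<le> u \<bullet> ?w - (2/K) * (?w \<bullet> ?w) + (1/K)\<^sup>2 * (K * (norm ?w)\<^sup>2)"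
    by (intro add_left_mono mult_left_mono bnd) auto
  also have "\<dots> = u \<bullet> ?w - (norm ?w)\<^sup>2 / K"
    using K by (simp add: power2_norm_eq_inner[symmetric] field_simps power2_eq_square)
  finally show ?thesis using K by (simp add: field_simps)
qed

text \<open>\<open>E\<close> stands for \<beta> B. The form of H + \<mu> I is at least \<mu> times
  the squared norm, and \<open>E\<close> has norm at most 1, which bounds \<open>d\<close>. For the
  slope, \<open>d\<close> is split into the solution with right side -g and a correction caused by
  \<open>E\<close>, whose norm bound makes it cost only the fraction \<open>b\<close> of the
  descent.\<close>

lemma lms_direction:
  fixes H E :: "real^'n^'n" and b \<mu> :: real
  assumes sym: "\<And>u v. u \<bullet> (H *v v) = v \<bullet> (H *v u)"
    and psd: "\<And>v. 0 \<le> v \<bullet> (H *v v)"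
    and \<mu>: "0 < \<mu>" and b: "0 < b" "b < 1"
    and E: "spectral_norm E \<le> b * \<mu> / (spectral_norm H + \<mu>)"
    and d: "(H + \<mu> *\<^sub>R mat 1) *v d = (E - mat 1) *v g"
  shows "norm d \<le> 2 * norm g / \<mu>"
    and "d \<bullet> g \<le> - ((1 - b) * (norm g)\<^sup>2 / (spectral_norm H + \<mu>))"
proof -
  let ?h = "spectral_norm H"
  let ?M = "H + \<mu> *\<^sub>R mat 1"
  have h: "0 \<le> ?h" by (rule spectral_norm_nonneg)
  have M: "?M *v v = H *v v + \<mu> *\<^sub>R v" for v
    by (simp add: matrix_vector_mult_add_rdistrib scaleR_matrix_vector_assoc[symmetric])
  have coer: "\<mu> * (norm v)\<^sup>2 \<le> v \<bullet> (?M *v v)" for v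
    using psd[of v] by (simp add: M inner_add_right power2_norm_eq_inner)
  have lower: "\<mu> * norm v \<le> norm (?M *v v)" for v
  proof -
    have "\<mu> * (norm v)\<^sup>2 \<le> norm v * norm (?M *v v)"
      using coer[of v] norm_cauchy_schwarz[of v "?M *v v"] by linarith
    then have "norm v * (\<mu> * norm v) \<le> norm v * norm (?M *v v)"
      by (simp add: power2_eq_square mult_ac)
    then show ?thesis by (cases "v = 0") auto
  qed
  have "b * \<mu> / (?h + \<mu>) \<le> 1"
  proof -
    have "b * \<mu> \<le> 1 * \<mu>" using b \<mu> by (intro mult_right_mono) auto
    then show ?thesis using h \<mu> by (subst divide_le_eq_1_pos) linarith+
  qed
  then have E1: "norm (E *v v) \<le> norm v" for v
    using norm_matrix_vector_le[of E v] E mult_right_mono[of "spectral_norm E" 1 "norm v"] by auto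
  have Mg: "?M *v d = E *v g - g"
    using d by (simp add: matrix_vector_mult_diff_rdistrib)
  have "\<mu> * norm d \<le> norm (E *v g) + norm g"
    using lower[of d] norm_triangle_ineq4[of "E *v g" g] unfolding Mg by linarith
  also have "\<dots> \<le> 2 * norm g" using E1[of g] by simp
  finally show "norm d \<le> 2 * norm g / \<mu>" using \<mu> by (simp add: field_simps)
  have lin: "linear ((*v) ?M)" by (rule matrix_vector_mul_linear)
  have inj: "inj ((*v) ?M)"
  proof (subst linear_injective_0[OF lin], intro allI impI)
    fix v assume "?M *v v = 0"
    then show "v = 0" using lower[of v] \<mu> by (simp add: mult_le_0_iff)
  qed
  then have "surj ((*v) ?M)" using lin by (intro linear_injective_imp_surjective refl)
  \<comment> \<open>With M = H + \<mu> I, injectivity gives surjectivity in finite dimension. Here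
    -u is the direction for \<open>E\<close> = 0 and w is the correction, so d = w - u.\<close>
  then obtain u w where u: "g = ?M *v u" and w: "E *v g = ?M *v w"
    by (metis surjD)
  have "?M *v d = ?M *v (w - u)"
    unfolding Mg by (simp add: matrix_vector_mult_diff_distrib u[symmetric] w[symmetric])
  then have dwu: "d = w - u" using inj by (simp add: inj_eq)
  \<comment> \<open>As M u = g, this bounds u . g from below by |g|^2 / (h + \<mu>), without using
    the inverse of M.\<close>
  have "(norm (?M *v u))\<^sup>2 \<le> (?h + \<mu>) * (u \<bullet> (?M *v u))"
  proof (rule psd_norm_mult_le)
    show "x \<bullet> (?M *v y) = y \<bullet> (?M *v x)" for x y
      by (simp add: M inner_add_right sym[of x y] inner_commute)
    show "0 \<le> v \<bullet> (?M *v v)" for v 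
      using coer[of v] \<mu> by (intro order_trans[OF _ coer]) auto
    show "v \<bullet> (?M *v v) \<le> (?h + \<mu>) * (norm v)\<^sup>2" for v
    proof -
      have "v \<bullet> (H *v v) \<le> norm v * (?h * norm v)"
        by (meson norm_cauchy_schwarz norm_matrix_vector_le mult_left_mono norm_ge_zero order_trans)
      then show ?thesis
        unfolding M inner_add_right distrib_right
        by (simp add: power2_norm_eq_inner[symmetric] power2_eq_square mult_ac)
    qed
    show "0 < ?h + \<mu>" using h \<mu> by simp
  qed
  then have ug: "(norm g)\<^sup>2 / (?h + \<mu>) \<le> u \<bullet> g"
    using h \<mu> by (simp add: u[symmetric] field_simps)
  have "\<mu> * norm w \<le> norm (E *v g)" using lower[of w] by (simp add: w)
  also have "\<dots> \<le> b * \<mu> / (?h + \<mu>) * norm g"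
    using norm_matrix_vector_le[of E g] mult_right_mono[OF E norm_ge_zero[of g]] by linarith
  finally have "\<mu> * norm w \<le> \<mu> * (b / (?h + \<mu>) * norm g)" by (simp add: mult_ac)
  then have "norm w \<le> b / (?h + \<mu>) * norm g" using \<mu> by (rule mult_left_le_imp_le)
  then have "w \<bullet> g \<le> b / (?h + \<mu>) * norm g * norm g"
    by (meson norm_cauchy_schwarz mult_right_mono norm_ge_zero order_trans)
  then have wg: "w \<bullet> g \<le> b * (norm g)\<^sup>2 / (?h + \<mu>)" by (simp add: power2_eq_square mult_ac)
  have "d \<bullet> g \<le> b * (norm g)\<^sup>2 / (?h + \<mu>) - (norm g)\<^sup>2 / (?h + \<mu>)"
    using ug wg by (simp add: dwu inner_diff_left)
  then show "d \<bullet> g \<le> - ((1 - b) * (norm g)\<^sup>2 / (?h + \<mu>))"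
    by (simp add: diff_divide_distrib left_diff_distrib)
qed

section \<open>Quadratic models of the residual and of the objective\<close>

text \<open>On the ball of radius |s| around x the derivative differs from J(x) by at most L |s|, so
  the mean value inequality gives the constant L instead of the sharper L / 2.\<close>

lemma residual_linearization:
  fixes R :: "real^'n \<Rightarrow> real^'m"
  assumes R: "\<And>y. (R has_derivative ((*v) (J y))) (at y)"
    and J: "\<And>y z. spectral_norm (J y - J z) \<le> L * norm (y - z)" and L: "0 \<le> L"
  shows "norm (R (x + s) - R x - J x *v s) \<le> L * (norm s)\<^sup>2"
proof -
  let ?S = "cball x (norm s)"
  have "norm (R (x + s) - R x - J x *v (x + s - x)) \<le> norm (x + s - x) * (L * norm s)"
  proof (rule differentiable_bound_linearization[where S = ?S and f' = "\<lambda>y. (*v) (J y)"])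
    show "x + t *\<^sub>R (x + s - x) \<in> ?S" if "t \<in> {0..1}" for t
      using that by (auto simp: dist_norm mult_left_le_one_le)
    show "(R has_derivative (*v) (J y)) (at y within ?S)" for y
      using R by (rule has_derivative_at_withinI)
    show "onorm ((*v) (J y) - (*v) (J x)) \<le> L * norm s" if "y \<in> ?S" for y
    proof -
      have "(*v) (J y) - (*v) (J x) = (*v) (J y - J x)"
        by (auto simp: matrix_vector_mult_diff_rdistrib)
      then have "onorm ((*v) (J y) - (*v) (J x)) \<le> L * norm (y - x)"
        using J[of y x] by (simp add: spectral_norm_def)
      also have "\<dots> \<le> L * norm s"
        using that L by (intro mult_left_mono) (auto simp: dist_norm norm_minus_commute)
      finally show ?thesis .
    qed
  qed auto
  then show ?thesis by (simp add: power2_eq_square mult_ac)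
qed

text \<open>Expand half the square of R(x) + J(x) s + e, where e is the linearization error. The
  linear term is s . g; all others carry a factor |s|^2, which is pulled out.\<close>

lemma least_squares_upper_bound:
  fixes R :: "real^'n \<Rightarrow> real^'m"
  assumes R: "\<And>y. (R has_derivative ((*v) (J y))) (at y)"
    and J: "\<And>y z. spectral_norm (J y - J z) \<le> L * norm (y - z)" and L: "0 \<le> L"
  shows "least_squares R (x + s) \<le> least_squares R x + s \<bullet> (transpose (J x) *v R x)
    + ((spectral_norm (J x))\<^sup>2 / 2 + L * norm (R x) + L * (spectral_norm (J x) * norm s)
       + L\<^sup>2 * (norm s)\<^sup>2 / 2) * (norm s)\<^sup>2"
proof -
  define e where "e = R (x + s) - R x - J x *v s"
  let ?q = "J x *v s" and ?j = "spectral_norm (J x)" and ?n = "norm s"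
  have e: "norm e \<le> L * ?n\<^sup>2"
    unfolding e_def by (rule residual_linearization[OF R J L])
  have q: "norm ?q \<le> ?j * ?n" by (rule norm_matrix_vector_le)
  have "R (x + s) = R x + ?q + e" by (simp add: e_def)
  then have "least_squares R (x + s) = least_squares R x + R x \<bullet> ?q + (norm ?q)\<^sup>2 / 2
      + R x \<bullet> e + ?q \<bullet> e + (norm e)\<^sup>2 / 2"
    by (simp add: least_squares_def power2_norm_eq_inner inner_add_left inner_add_right
        inner_commute algebra_simps add_divide_distrib)
  moreover have "(norm ?q)\<^sup>2 \<le> (?j * ?n)\<^sup>2" by (intro power_mono q) auto
  moreover have "(norm e)\<^sup>2 \<le> (L * ?n\<^sup>2)\<^sup>2" by (intro power_mono e) auto
  moreover have "R x \<bullet> e \<le> norm (R x) * (L * ?n\<^sup>2)"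
    by (meson norm_cauchy_schwarz e mult_left_mono norm_ge_zero order_trans)
  moreover have "?q \<bullet> e \<le> (?j * ?n) * (L * ?n\<^sup>2)"
    using norm_cauchy_schwarz[of ?q e] mult_mono[OF q e] spectral_norm_nonneg[of "J x"] by simp
  moreover have "s \<bullet> (transpose (J x) *v R x) = R x \<bullet> ?q"
    by (metis inner_commute inner_transpose_mult)
  ultimately show ?thesis
    by (simp add: algebra_simps power2_eq_square)
qed

section \<open>The regularization parameter\<close>

text \<open>The factor (1 + b)^2 / (1 - b) is at least 1, so \<mu> is at least 1 plus any entry of
  the maximum; the entries used are the last two.\<close>

lemma lms_mu_lower_bounds:
  assumes b: "0 < b" "b < 1" and nn: "0 \<le> l" "0 \<le> h" "0 \<le> j" "0 \<le> r"
  shows "1 \<le> lms_mu b l h j r" "j\<^sup>2 \<le> lms_mu b l h j r" "l * r \<le> lms_mu b l h j r"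
    "h * j\<^sup>2 \<le> lms_mu b l h j r"
proof -
  let ?a = "j\<^sup>2 + l * r" and ?a' = "h * j\<^sup>2 + l * h * r + l * j\<^sup>2 * r"
  let ?m = "Max {l\<^sup>2 / 4 * h * j * r, l\<^sup>2 / 4 * j * r + l * h * j\<^sup>2 * r, ?a', ?a}"
  have m: "?a \<le> ?m" "?a' \<le> ?m" by (auto intro!: Max_ge)
  have "1 - b \<le> (1 + b)\<^sup>2" using b by (simp add: power2_eq_square algebra_simps)
  then have "1 \<le> (1 + b)\<^sup>2 / (1 - b)" using b by simp
  moreover have "0 \<le> ?m" using m(1) nn by (meson add_nonneg_nonneg mult_nonneg_nonneg order_trans zero_le_power2)
  ultimately have "1 * ?m \<le> (1 + b)\<^sup>2 / (1 - b) * ?m" by (intro mult_right_mono)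
  then have *: "1 + ?m \<le> lms_mu b l h j r" by (simp add: lms_mu_def)
  show "1 \<le> lms_mu b l h j r" using * \<open>0 \<le> ?m\<close> by linarith
  have nn': "0 \<le> l * r" "0 \<le> l * h * r" "0 \<le> l * j\<^sup>2 * r" using nn by auto
  show "j\<^sup>2 \<le> lms_mu b l h j r" using * m nn' by linarith
  show "l * r \<le> lms_mu b l h j r" using * m zero_le_power2[of j] by linarith
  show "h * j\<^sup>2 \<le> lms_mu b l h j r" using * m nn' by linarith
qed

text \<open>All entries of the maximum are monotone in nonnegative arguments. This turns bounds on
  l, h, j and r into a bound on \<mu>.\<close>

lemma lms_mu_mono:
  assumes "b < 1" and "0 \<le> l" "0 \<le> h" "0 \<le> j" "0 \<le> r"
    and le: "l \<le> l'" "h \<le> h'" "j \<le> j'" "r \<le> r'"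
  shows "lms_mu b l h j r \<le> lms_mu b l' h' j' r'"
proof -
  have max4: "Max {a, a', a'', a'''} \<le> Max {e, e', e'', e'''}"
    if "a \<le> e" "a' \<le> e'" "a'' \<le> e''" "a''' \<le> e'''" for a a' a'' a''' e e' e'' e''' :: real
    using that by (auto simp: le_max_iff_disj)
  have "Max {l\<^sup>2 / 4 * h * j * r, l\<^sup>2 / 4 * j * r + l * h * j\<^sup>2 * r,
      h * j\<^sup>2 + l * h * r + l * j\<^sup>2 * r, j\<^sup>2 + l * r}
    \<le> Max {l'\<^sup>2 / 4 * h' * j' * r', l'\<^sup>2 / 4 * j' * r' + l' * h' * j'\<^sup>2 * r',
      h' * j'\<^sup>2 + l' * h' * r' + l' * j'\<^sup>2 * r', j'\<^sup>2 + l' * r'}"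
    using assms by (intro max4 add_mono mult_mono power_mono divide_right_mono) auto
  then show ?thesis
    unfolding lms_mu_def using \<open>b < 1\<close> by (intro add_left_mono mult_left_mono) auto
qed

section \<open>Acceptance of a step and one iteration\<close>

text \<open>The bracket in the quadratic model is at most \<mu> times the bracket in
  \<open>accept\<close>, because |d| \<le> 2 j r / \<mu>, j^2 \<le> \<mu> and l r \<le> \<mu>. With
  |s d| \<le> 2 s |g| / \<mu> the model error is of order s^2 |g|^2 / \<mu>. The slack s (1 - c) |d
  . g| is at least s (1 - c) (1 - b) |g|^2 / (C \<mu>), and \<open>accept\<close> says that the
  ratio of the two bounds is at most 1.\<close>

lemma lms_armijo:
  fixes R :: "real^'n \<Rightarrow> real^'m"
  assumes R: "\<And>y. (R has_derivative ((*v) (J y))) (at y)"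
    and J: "\<And>y z. spectral_norm (J y - J z) \<le> L * norm (y - z)" and L: "0 \<le> L"
    and c: "c < 1" and b: "b < 1" and l: "0 < l" and \<mu>: "0 < \<mu>"
    and j\<mu>: "(spectral_norm (J x))\<^sup>2 \<le> \<mu>" and r\<mu>: "l * norm (R x) \<le> \<mu>"
    and h: "0 \<le> h" "h + \<mu> \<le> C * \<mu>"
    and g: "g = transpose (J x) *v R x"
    and dn: "norm d \<le> 2 * norm g / \<mu>"
    and dg: "d \<bullet> g \<le> - ((1 - b) * (norm g)\<^sup>2 / (h + \<mu>))"
    and s: "0 < s" "s \<le> 1"
    and accept: "s * (4 * C / ((1 - c) * (1 - b))) *
      ((spectral_norm (J x))\<^sup>2 / \<mu> / 2 + 3 * (L / l) + 2 * (L / l)\<^sup>2) \<le> 1"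
  shows "least_squares R (x + s *\<^sub>R d) \<le> least_squares R x + c * s * (d \<bullet> g)"
proof -
  let ?j = "spectral_norm (J x)" and ?r = "norm (R x)" and ?n = "norm (s *\<^sub>R d)"
  let ?Q = "?j\<^sup>2 / \<mu> / 2 + 3 * (L / l) + 2 * (L / l)\<^sup>2"
  have j: "0 \<le> ?j" by (rule spectral_norm_nonneg)
  have gjr: "norm g \<le> ?j * ?r" unfolding g by (rule norm_transpose_mult_le)
  have ns: "?n \<le> s * (2 * norm g / \<mu>)"
    using s dn by (simp only: norm_scaleR abs_of_pos) (intro mult_left_mono, auto)
  also have "\<dots> \<le> 1 * (2 * norm g / \<mu>)"
    using s \<mu> by (intro mult_right_mono) auto
  also have "\<dots> \<le> 2 * (?j * ?r) / \<mu>"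
    using gjr \<mu> by (simp add: divide_right_mono)
  finally have n: "?n \<le> 2 * ?j * ?r / \<mu>" by simp
  have rl: "?r \<le> \<mu> / l" using r\<mu> l by (simp add: field_simps)
  have p1: "?j\<^sup>2 / \<mu> \<le> 1" using j\<mu> \<mu> by simp
  have 1: "L * ?r \<le> \<mu> * (L / l)"
    using mult_left_mono[OF rl L] by (simp add: mult_ac)
  have "?j * ?n \<le> ?j * (2 * ?j * ?r / \<mu>)" by (intro mult_left_mono n j)
  also have "\<dots> = ?j\<^sup>2 / \<mu> * (2 * ?r)" by (simp add: power2_eq_square)
  also have "\<dots> \<le> 1 * (2 * (\<mu> / l))" using p1 rl by (intro mult_mono) auto
  finally have 2: "L * (?j * ?n) \<le> \<mu> * (2 * (L / l))"
    using mult_left_mono[OF _ L] by (fastforce simp: mult_ac)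
  have "?n\<^sup>2 \<le> (2 * ?j * ?r / \<mu>)\<^sup>2" by (intro power_mono n) auto
  also have "\<dots> = ?j\<^sup>2 / \<mu> * (4 * ?r\<^sup>2 / \<mu>)"
    by (simp add: power_mult_distrib power_divide power2_eq_square)
  also have "\<dots> \<le> 1 * (4 * (\<mu> / l)\<^sup>2 / \<mu>)"
    using p1 rl \<mu> by (intro mult_mono divide_right_mono power_mono) auto
  also have "\<dots> = \<mu> * (4 / l\<^sup>2)" using \<mu> by (simp add: power_divide power2_eq_square)
  finally have 3: "L\<^sup>2 * ?n\<^sup>2 / 2 \<le> \<mu> * (2 * (L / l)\<^sup>2)"
    using mult_left_mono[of "?n\<^sup>2" "\<mu> * (4 / l\<^sup>2)" "L\<^sup>2"] by (simp add: power_divide mult_ac)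
  \<comment> \<open>The coefficient 3 of L / l collects one unit from L r and two from L j |s
    d|.\<close>
  have bracket: "?j\<^sup>2 / 2 + L * ?r + L * (?j * ?n) + L\<^sup>2 * ?n\<^sup>2 / 2 \<le> \<mu> * ?Q"
  proof -
    have "?j\<^sup>2 / 2 = \<mu> * (?j\<^sup>2 / \<mu> / 2)" using \<mu> by simp
    moreover have "\<mu> * ?Q = \<mu> * (?j\<^sup>2 / \<mu> / 2) + \<mu> * (L / l) + \<mu> * (2 * (L / l)) + \<mu> * (2 * (L / l)\<^sup>2)"
      by (simp add: algebra_simps)
    ultimately show ?thesis using 1 2 3 by linarith
  qed
  have Q: "0 \<le> ?Q" using \<mu> l L by simp
  have C: "0 < C" using h \<mu> by (smt (verit) mult_nonpos_nonneg)
  have cb: "0 < (1 - c) * (1 - b)" using c b by simp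
  have "(?j\<^sup>2 / 2 + L * ?r + L * (?j * ?n) + L\<^sup>2 * ?n\<^sup>2 / 2) * ?n\<^sup>2
      \<le> (\<mu> * ?Q) * (s * (2 * norm g / \<mu>))\<^sup>2"
    using bracket ns Q \<mu> by (intro mult_mono power_mono) auto
  also have "\<dots> = (s * (4 * C / ((1 - c) * (1 - b))) * ?Q)
      * (s * ((1 - c) * (1 - b)) * (norm g)\<^sup>2 / (C * \<mu>))"
    using \<mu> C b c by (simp add: power2_eq_square)
  also have "\<dots> \<le> 1 * (s * ((1 - c) * (1 - b)) * (norm g)\<^sup>2 / (C * \<mu>))"
    using accept s C \<mu> cb by (intro mult_right_mono) auto
  also have "\<dots> \<le> s * ((1 - c) * (1 - b)) * (norm g)\<^sup>2 / (h + \<mu>)"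
    unfolding mult_1 using h \<mu> s cb C by (intro divide_left_mono) auto
  also have "\<dots> = (s * (1 - c)) * ((1 - b) * (norm g)\<^sup>2 / (h + \<mu>))" by simp
  also have "\<dots> \<le> (s * (1 - c)) * (- (d \<bullet> g))"
    using dg s c by (intro mult_left_mono) auto
  finally have "(?j\<^sup>2 / 2 + L * ?r + L * (?j * ?n) + L\<^sup>2 * ?n\<^sup>2 / 2) * ?n\<^sup>2
      \<le> - (s * (1 - c)) * (d \<bullet> g)" by simp
  moreover have "s *\<^sub>R d \<bullet> g = s * (d \<bullet> g)" by simp
  ultimately show ?thesis
    using least_squares_upper_bound[OF R J L, of x "s *\<^sub>R d"] unfolding g[symmetric]
    by (simp add: algebra_simps)
qed

text \<open>An interface to one iteration that hides \<beta>, the direction and the cap on the step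
  length. \<open>Q\<close> includes the constant factor, so a step s below the cap is accepted once
  s \<open>Q\<close> \<le> 1.\<close>

lemma lms_step_properties:
  fixes R :: "real^'n \<Rightarrow> real^'m" and x :: "real^'n"
  assumes R: "\<And>y. (R has_derivative ((*v) (J y))) (at y)"
    and J: "\<And>y z. spectral_norm (J y - J z) \<le> L * norm (y - z)" and L: "0 \<le> L"
    and P: "partition_on UNIV P"
    and c: "0 < c" "c < 1" and b: "0 < b" "b < 1" and l: "0 < l"
    and step: "lms_step R J P c b \<eta> lmin x l x' l'"
    and j: "j = spectral_norm (J x)"
    and h: "h = spectral_norm (block_diag_part P (transpose (J x) ** J x))"
    and \<mu>: "\<mu> = lms_mu b l h j (norm (R x))"
    and g: "g = transpose (J x) *v R x"
    and Q: "Q = 4 * (1 + (real CARD('n))\<^sup>2) / ((1 - c) * (1 - b)) *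
      (j\<^sup>2 / \<mu> / 2 + 3 * (L / l) + 2 * (L / l)\<^sup>2)"
  obtains t where "0 < t"
    and "least_squares R x' \<le> least_squares R x - c * t * ((1 - b) * (norm g)\<^sup>2 / (h + \<mu>))"
    and "\<And>s. 0 < s \<Longrightarrow> s \<le> 1 / 2 \<Longrightarrow> s * Q \<le> 1 \<Longrightarrow> s \<le> t"
    and "l' = 2 * l \<and> 1 < Q \<or> l' = l \<or> l' = max lmin (l / 2)"
proof -
  define H where "H = block_diag_part P (transpose (J x) ** J x)"
  define B where "B = transpose (J x) ** J x - H"
  have hH: "h = spectral_norm H" by (simp add: h H_def)
  note step' = step[unfolded lms_step_def Let_def, folded H_def, folded B_def hH j g, folded \<mu>]
  obtain \<beta> d t where E: "spectral_norm (\<beta> *\<^sub>R B) \<le> b * \<mu> / (h + \<mu>)"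
    and d: "(H + \<mu> *\<^sub>R mat 1) *v d = (\<beta> *\<^sub>R B - mat 1) *v g"
    and t: "t \<in> {s. 0 < s \<and> s \<le> min 1 (1 / spectral_norm (mat 1 - \<beta> *\<^sub>R B)) \<and>
        least_squares R (x + s *\<^sub>R d) \<le> least_squares R x + c * s * (d \<bullet> g)}"
    and tge: "\<forall>s\<in>{s. 0 < s \<and> s \<le> min 1 (1 / spectral_norm (mat 1 - \<beta> *\<^sub>R B)) \<and>
        least_squares R (x + s *\<^sub>R d) \<le> least_squares R x + c * s * (d \<bullet> g)}. s \<le> t"
    and x': "x' = x + t *\<^sub>R d"
    and l': "l' = (if t < min 1 (1 / spectral_norm (mat 1 - \<beta> *\<^sub>R B)) then 2 * l
      else if \<eta> * (least_squares R x - (norm (R x + J x *v d))\<^sup>2 - \<mu> * (norm d)\<^sup>2)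
        < least_squares R x' - least_squares R x then max lmin (l / 2) else l)"
    using step' by (elim exE conjE) (rule that)
  define \<gamma> where \<gamma>: "\<gamma> = spectral_norm (mat 1 - \<beta> *\<^sub>R B)"
  define tmax where tmax: "tmax = min 1 (1 / \<gamma>)"
  define T where T: "T = {s. 0 < s \<and> s \<le> tmax \<and>
      least_squares R (x + s *\<^sub>R d) \<le> least_squares R x + c * s * (d \<bullet> g)}"
  have t: "t \<in> T" "\<And>s. s \<in> T \<Longrightarrow> s \<le> t"
    using t tge unfolding T tmax \<gamma> by blast+
  have l': "t < tmax \<Longrightarrow> l' = 2 * l" "\<not> t < tmax \<Longrightarrow> l' = l \<or> l' = max lmin (l / 2)"
    using l'[folded \<gamma>, folded tmax] by (simp_all split: if_splits)
  have h0: "0 \<le> h" and j0: "0 \<le> j" unfolding h j by (auto intro: spectral_norm_nonneg)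
  note \<mu>_bounds = lms_mu_lower_bounds[OF b, of l h j "norm (R x)", folded \<mu>]
  have \<mu>1: "1 \<le> \<mu>" and \<mu>j: "j\<^sup>2 \<le> \<mu>" and \<mu>r: "l * norm (R x) \<le> \<mu>"
    using \<mu>_bounds l h0 j0 by auto
  have \<mu>0: "0 < \<mu>" using \<mu>1 by simp
  have sym: "u \<bullet> (H *v v) = v \<bullet> (H *v u)" for u v
    unfolding H_def by (rule block_diag_part_symmetric) (simp add: transpose_mult_entry inner_commute)
  have psd: "0 \<le> v \<bullet> (H *v v)" for v
    unfolding H_def by (rule block_diag_part_gram_psd[OF P])
  note dir = lms_direction[OF sym psd \<mu>0 b E[unfolded hH] d, folded hH]
  have "h \<le> (real CARD('n))\<^sup>2 * \<mu>"
    using spectral_norm_block_diag_part_gram_le[of P "J x"] \<mu>j unfolding h j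
    by (meson mult_left_mono order_trans zero_le_power2)
  then have hC: "h + \<mu> \<le> (1 + (real CARD('n))\<^sup>2) * \<mu>" by (simp add: algebra_simps)
  \<comment> \<open>Every admissible step with s \<open>Q\<close> \<le> 1 passes the decrease test.
    Maximality of \<open>t\<close> turns this into a lower bound for \<open>t\<close>.\<close>
  have inT: "s \<in> T" if "0 < s" "s \<le> tmax" "s * Q \<le> 1" for s
  proof -
    have "s \<le> 1" using that tmax by simp
    then have "least_squares R (x + s *\<^sub>R d) \<le> least_squares R x + c * s * (d \<bullet> g)"
      using that \<mu>j \<mu>r
      by (intro lms_armijo[OF R J L c(2) b(2) l \<mu>0 _ _ h0 hC g dir])
        (auto simp: j[symmetric] Q mult.assoc)
    then show ?thesis using that T by simp
  qed
  have t0: "0 < t" "t \<le> tmax" using t(1) T by auto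
  have "\<gamma> \<le> 2"
  proof -
    have "b * \<mu> \<le> 1 * \<mu>" using b \<mu>0 by (intro mult_right_mono) auto
    then have "b * \<mu> / (h + \<mu>) \<le> 1"
      using h0 \<mu>0 by (subst divide_le_eq_1_pos) linarith+
    then have B1: "spectral_norm (\<beta> *\<^sub>R B) \<le> 1" using E by simp
    show ?thesis unfolding \<gamma>
    proof (rule spectral_norm_le)
      fix v
      have "norm ((mat 1 - \<beta> *\<^sub>R B) *v v) \<le> norm v + norm ((\<beta> *\<^sub>R B) *v v)"
        by (simp add: matrix_vector_mult_diff_rdistrib norm_triangle_ineq4)
      also have "\<dots> \<le> norm v + 1 * norm v"
        using norm_matrix_vector_le[of "\<beta> *\<^sub>R B" v] mult_right_mono[OF B1 norm_ge_zero[of v]] by linarith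
      finally show "norm ((mat 1 - \<beta> *\<^sub>R B) *v v) \<le> 2 * norm v" by simp
    qed
  qed
  \<comment> \<open>Division by zero yields 0, so this also rules out \<gamma> = 0; it follows from
    the existence of a positive accepted step.\<close>
  moreover have "0 < 1 / \<gamma>" using t0 tmax by linarith
  ultimately have half: "1 / 2 \<le> tmax"
    unfolding tmax using divide_left_mono[of \<gamma> 2 1] by simp
  show thesis
  proof (rule that[OF t0(1)])
    have "least_squares R x' \<le> least_squares R x + c * t * (d \<bullet> g)"
      using t(1) T x' by simp
    also have "\<dots> \<le> least_squares R x + c * t * (- ((1 - b) * (norm g)\<^sup>2 / (h + \<mu>)))"
      using c t0 by (intro add_left_mono mult_left_mono dir) auto
    finally show "least_squares R x' \<le> least_squares R x - c * t * ((1 - b) * (norm g)\<^sup>2 / (h + \<mu>))"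
      by simp
    show "s \<le> t" if "0 < s" "s \<le> 1 / 2" "s * Q \<le> 1" for s
      using that half by (intro t(2) inT) auto
    \<comment> \<open>Since \<open>tmax\<close> \<le> 1, \<open>Q\<close> \<le> 1 would make
      \<open>tmax\<close> itself acceptable. So l is doubled only when \<open>Q\<close> exceeds
      1.\<close>
    have "1 < Q" if "t < tmax"
    proof (rule ccontr)
      assume "\<not> 1 < Q"
      have "tmax \<le> 1" "0 \<le> tmax" using half tmax by linarith+
      then have "tmax * Q \<le> 1" using \<open>\<not> 1 < Q\<close> mult_left_mono[of Q 1 tmax] by linarith
      then have "tmax \<in> T" using half by (intro inT) auto
      then show False using t(2) that by fastforce
    qed
    then show "l' = 2 * l \<and> 1 < Q \<or> l' = l \<or> l' = max lmin (l / 2)" using l' by blast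
  qed
qed

section \<open>Convergence\<close>

text \<open>In this form it bounds the Jacobian at an iterate by the Jacobian at the accumulation
  point plus the Lipschitz term.\<close>

lemma spectral_norm_triangle: "spectral_norm A \<le> spectral_norm B + spectral_norm (A - B)"
proof (rule spectral_norm_le)
  fix v
  have "A *v v = B *v v + (A - B) *v v" by (simp add: matrix_vector_mult_diff_rdistrib)
  then have "norm (A *v v) \<le> norm (B *v v) + norm ((A - B) *v v)"
    by (simp only: norm_triangle_ineq)
  also have "\<dots> \<le> (spectral_norm B + spectral_norm (A - B)) * norm v"
    using norm_matrix_vector_le[of B v] norm_matrix_vector_le[of "A - B" v]
    by (simp add: distrib_right)
  finally show "norm (A *v v) \<le> (spectral_norm B + spectral_norm (A - B)) * norm v" .
qed

lemma tendsto_transpose_matrix_vector: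
  fixes A :: "'a \<Rightarrow> real^'n^'m"
  assumes "(A \<longlongrightarrow> A0) F" "(v \<longlongrightarrow> v0) F"
  shows "((\<lambda>n. transpose (A n) *v v n) \<longlongrightarrow> transpose A0 *v v0) F"
  unfolding matrix_vector_mult_def transpose_def
  by (rule vec_tendstoI, unfold vec_lambda_beta)
    (intro tendsto_sum tendsto_mult tendsto_vec_nth assms)

theorem theorem2:
  fixes R :: "real^'n \<Rightarrow> real^'m"
    and J :: "real^'n \<Rightarrow> real^'n^'m"
    and P :: "'n set set"
    and c b \<eta> lmin l0 L :: real
    and x0 xbar :: "real^'n"
    and x :: "nat \<Rightarrow> real^'n"
  assumes "\<And>y. (R has_derivative ((*v) (J y))) (at y)"
    and "continuous_on UNIV J"
    and "\<And>y z. spectral_norm (J y - J z) \<le> L * norm (y - z)"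
    and "partition_on UNIV P"
    and "0 < c" "c < 1"
    and "0 < b" "b < 1"
    and "0 \<le> \<eta>" "\<eta> < 1"
    and "0 < lmin" "lmin < l0"
    and "lms_sequence R J P c b \<eta> lmin l0 x0 x"
    and "accumulation_point x xbar"
  shows "transpose (J xbar) *v R xbar = 0"
proof (cases "R xbar = 0")
  case False
  note R = assms(1) and P = assms(4) and c = assms(5,6) and b = assms(7,8) and lmin = assms(11,12)
  \<comment> \<open>Passing to the absolute value keeps the Lipschitz estimate and provides a
    nonnegative constant.\<close>
  define L' where "L' = \<bar>L\<bar>"
  have L': "0 \<le> L'" by (simp add: L'_def)
  have J: "spectral_norm (J y - J z) \<le> L' * norm (y - z)" for y z
    using assms(3)[of y z] mult_right_mono[OF abs_ge_self[of L] norm_ge_zero[of "y - z"]]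
    unfolding L'_def by linarith
  define F where "F k = least_squares R (x k)" for k
  define \<rho> where "\<rho> = norm (R xbar)"
  have \<rho>: "0 < \<rho>" using False by (simp add: \<rho>_def)
  obtain l where l0: "l 0 = l0"
    and step: "\<And>k. lms_step R J P c b \<eta> lmin (x k) (l k) (x (Suc k)) (l (Suc k))"
    using assms(13) unfolding lms_sequence_def by blast
  obtain r where r: "strict_mono r" and xr: "(\<lambda>n. x (r n)) \<longlonglongrightarrow> xbar"
    using assms(14) unfolding accumulation_point_def comp_def by blast
  define j where "j k = spectral_norm (J (x k))" for k
  define h where "h k = spectral_norm (block_diag_part P (transpose (J (x k)) ** J (x k)))" for k
  define \<mu> where "\<mu> k = lms_mu b (l k) (h k) (j k) (norm (R (x k)))" for k
  define g where "g k = transpose (J (x k)) *v R (x k)" for k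
  define K where "K = 4 * (1 + (real CARD('n))\<^sup>2) / ((1 - c) * (1 - b))"
  define Q where "Q k = K * ((j k)\<^sup>2 / \<mu> k / 2 + 3 * (L' / l k) + 2 * (L' / l k)\<^sup>2)" for k
  note props = lms_step_properties[OF R J L' P c b _ step j_def h_def \<mu>_def g_def
      Q_def[unfolded K_def]]
  \<comment> \<open>\<open>props\<close> asks for l > 0, so this bound comes before the step lengths
    are chosen for all iterations at once.\<close>
  have l_ge: "lmin \<le> l k" for k
  proof (induction k)
    case (Suc k)
    then have "0 < l k" using lmin by simp
    then have "l (Suc k) = 2 * l k \<or> l (Suc k) = l k \<or> l (Suc k) = max lmin (l k / 2)"
      by (rule props[of k]) auto
    then show ?case using Suc \<open>0 < l k\<close> by auto
  qed (use l0 lmin in simp)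
  have l_pos: "0 < l k" for k using l_ge[of k] lmin by simp
  have "\<exists>t>0. F (Suc k) \<le> F k - c * t * ((1 - b) * (norm (g k))\<^sup>2 / (h k + \<mu> k))
      \<and> (\<forall>s. 0 < s \<longrightarrow> s \<le> 1 / 2 \<longrightarrow> s * Q k \<le> 1 \<longrightarrow> s \<le> t)
      \<and> (l (Suc k) = 2 * l k \<and> 1 < Q k \<or> l (Suc k) = l k \<or> l (Suc k) = max lmin (l k / 2))" for k
    unfolding F_def by (rule props[OF l_pos[of k]]) blast
  then obtain t where t: "\<And>k. 0 < t k"
    and desc: "\<And>k. F (Suc k) \<le> F k - c * t k * ((1 - b) * (norm (g k))\<^sup>2 / (h k + \<mu> k))"
    and t_ge: "\<And>k s. 0 < s \<Longrightarrow> s \<le> 1 / 2 \<Longrightarrow> s * Q k \<le> 1 \<Longrightarrow> s \<le> t k"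
    and l_Suc: "\<And>k. l (Suc k) = 2 * l k \<and> 1 < Q k \<or> l (Suc k) = l k \<or> l (Suc k) = max lmin (l k / 2)"
    by metis
  have h0: "0 \<le> h k" and j0: "0 \<le> j k" for k
    unfolding h_def j_def by (auto intro: spectral_norm_nonneg)
  have \<mu>1: "1 \<le> \<mu> k" and \<mu>j: "(j k)\<^sup>2 \<le> \<mu> k" and \<mu>r: "l k * norm (R (x k)) \<le> \<mu> k"
    and \<mu>h: "h k * (j k)\<^sup>2 \<le> \<mu> k" for k
    unfolding \<mu>_def using b h0 j0 l_pos[of k] by (auto intro!: lms_mu_lower_bounds simp: less_imp_le)
  have hj: "h k \<le> (real CARD('n))\<^sup>2 * (j k)\<^sup>2" for k
    unfolding h_def j_def by (rule spectral_norm_block_diag_part_gram_le)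
  have jh: "(j k)\<^sup>2 \<le> (real CARD('n))\<^sup>2 * h k" for k
    unfolding h_def j_def by (rule spectral_norm_le_block_diag_part_gram[OF P])
  have \<mu>0: "0 < \<mu> k" for k using \<mu>1[of k] by simp
  have K: "0 < K" using c b by (simp add: K_def add_pos_nonneg)
  have "F (Suc k) \<le> F k" for k
  proof -
    have "0 \<le> c * t k * ((1 - b) * (norm (g k))\<^sup>2 / (h k + \<mu> k))"
      using c b t[of k] h0[of k] \<mu>0[of k] by simp
    then show ?thesis using desc[of k] by linarith
  qed
  then have dec: "decseq F" by (rule decseq_SucI)
  have Rr: "(\<lambda>n. R (x (r n))) \<longlonglongrightarrow> R xbar"
    using has_derivative_continuous[OF R] xr by (rule isCont_tendsto_compose)
  have "(\<lambda>n. F (r n)) \<longlonglongrightarrow> least_squares R xbar"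
    unfolding F_def least_squares_def by (intro tendsto_intros Rr)
  \<comment> \<open>F decreases along the whole sequence and tends to its value at
    \<open>xbar\<close> along a subsequence, so that value bounds every F k from below. The residual
    norms inherit the lower bound \<rho>.\<close>
  then have F_ge: "least_squares R xbar \<le> F k" for k
  proof (rule LIMSEQ_le_const2)
    show "\<exists>n0. \<forall>n\<ge>n0. F (r n) \<le> F k"
      using order_trans[OF _ seq_suble[OF r]] by (intro exI[of _ k] allI impI decseqD[OF dec]) blast
  qed
  have r_ge: "\<rho> \<le> norm (R (x k))" for k
    using F_ge[of k] unfolding F_def least_squares_def \<rho>_def
    by (simp add: power2_norm_eq_inner norm_le)
  have r_le: "norm (R (x k)) \<le> norm (R (x 0))" for k
    using decseqD[OF dec, of 0 k] unfolding F_def least_squares_def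
    by (simp add: power2_norm_eq_inner norm_le)
  \<comment> \<open>This is \<open>Q\<close> with j^2 / \<mu> replaced by 1 and l by
    \<open>lmin\<close>, hence an upper bound for all \<open>Q k\<close>.\<close>
  define C where "C = K * (1 / 2 + 3 * (L' / lmin) + 2 * (L' / lmin)\<^sup>2)"
  have QC: "Q k \<le> C" for k
  proof -
    have "L' / l k \<le> L' / lmin" using L' l_ge[of k] lmin by (intro divide_left_mono) auto
    then show ?thesis unfolding Q_def C_def
      using K \<mu>j[of k] \<mu>0[of k] L' l_pos[of k]
      by (intro mult_left_mono add_mono power_mono divide_right_mono) auto
  qed
  have C: "0 < C" using K L' lmin by (simp add: C_def add_pos_nonneg)
  define \<tau> where "\<tau> = min (1 / 2) (1 / C)"
  have \<tau>: "0 < \<tau>" using C by (simp add: \<tau>_def)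
  have t_lb: "\<tau> \<le> t k" for k
  proof (rule t_ge)
    have "\<tau> * Q k \<le> \<tau> * C" using QC[of k] \<tau> by (intro mult_left_mono) auto
    also have "\<dots> \<le> 1 / C * C" using C by (intro mult_right_mono) (auto simp: \<tau>_def)
    finally show "\<tau> * Q k \<le> 1" using C by simp
  qed (use \<tau> \<tau>_def in auto)
  \<comment> \<open>A majorant of \<open>Q\<close> that depends on l alone and tends to 0 at
    infinity; the square root bounds j^2 / \<mu>.\<close>
  define \<phi> where "\<phi> s = K * (sqrt ((real CARD('n))\<^sup>2 / \<rho> / s) / 2 + 3 * (L' / s) + 2 * (L' / s)\<^sup>2)" for s
  have inv: "((\<lambda>s. a / s) \<longlongrightarrow> 0) at_top" for a :: real
    by (intro real_tendsto_divide_at_top[OF tendsto_const filterlim_ident])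
  have "(\<phi> \<longlongrightarrow> K * (sqrt 0 / 2 + 3 * 0 + 2 * 0\<^sup>2)) at_top"
    unfolding \<phi>_def by (intro tendsto_intros inv) auto
  then have "eventually (\<lambda>s. \<phi> s < 1) at_top"
    by (intro order_tendstoD(2)) auto
  then obtain \<Lambda> where \<Lambda>: "\<And>s. \<Lambda> \<le> s \<Longrightarrow> \<phi> s < 1"
    by (auto simp: eventually_at_top_linorder)
  have Q\<phi>: "Q k \<le> \<phi> (l k)" for k
  proof -
    have "(j k)\<^sup>2 * (j k)\<^sup>2 \<le> (real CARD('n))\<^sup>2 * (h k * (j k)\<^sup>2)"
      using mult_right_mono[OF jh[of k], of "(j k)\<^sup>2"] by (simp add: mult_ac)
    also have "\<dots> \<le> (real CARD('n))\<^sup>2 * \<mu> k" by (intro mult_left_mono \<mu>h) auto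
    finally have "((j k)\<^sup>2 / \<mu> k)\<^sup>2 \<le> (real CARD('n))\<^sup>2 / \<mu> k"
      using \<mu>0[of k] by (simp add: power2_eq_square field_simps)
    also have "\<dots> \<le> (real CARD('n))\<^sup>2 / (\<rho> * l k)"
    proof (intro divide_left_mono)
      have "\<rho> * l k \<le> l k * norm (R (x k))"
        using mult_left_mono[OF r_ge[of k], of "l k"] l_pos[of k] by (simp add: mult_ac)
      then show "\<rho> * l k \<le> \<mu> k" using \<mu>r[of k] by simp
    qed (use \<rho> \<mu>0[of k] l_pos[of k] in auto)
    finally have "(j k)\<^sup>2 / \<mu> k \<le> sqrt ((real CARD('n))\<^sup>2 / \<rho> / l k)"
      by (intro real_le_rsqrt) simp
    then show ?thesis unfolding Q_def \<phi>_def using K by (intro mult_left_mono) auto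
  qed
  \<comment> \<open>Doubling needs 1 < \<open>Q k\<close>, hence \<phi>(l) > 1 and l < \<Lambda>.
    The factor 2 allows for one doubling from below \<Lambda>, and \<open>l0\<close> covers the
    start and, being above \<open>lmin\<close>, the floor.\<close>
  have l_le: "l k \<le> 2 * max \<Lambda> l0" for k
  proof (induction k)
    case (Suc k)
    have "l k < \<Lambda>" if "1 < Q k" using \<Lambda>[of "l k"] Q\<phi>[of k] that by force
    then show ?case using l_Suc[of k] Suc l_pos[of k] lmin by (auto simp: max_def split: if_splits)
  qed (use l0 lmin in auto)
  have "Bseq (\<lambda>n. x (r n) - xbar)"
    using xr by (intro convergent_imp_Bseq convergentI) (rule tendsto_diff[OF _ tendsto_const])
  then obtain D where D: "\<And>n. norm (x (r n) - xbar) \<le> D" by (auto simp: Bseq_def)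
  define jbar where "jbar = spectral_norm (J xbar) + L' * D"
  define hbar where "hbar = (real CARD('n))\<^sup>2 * jbar\<^sup>2"
  \<comment> \<open>An upper bound for h + \<mu> along the subsequence: j and h are bounded there by
    convergence, while l and the residual norm are bounded for all iterates.\<close>
  define W where "W = hbar + lms_mu b (2 * max \<Lambda> l0) hbar jbar (norm (R (x 0)))"
  have j_le: "j (r n) \<le> jbar" for n
    unfolding j_def jbar_def
    using spectral_norm_triangle[of "J (x (r n))" "J xbar"] J[of "x (r n)" xbar]
      mult_left_mono[OF D[of n] L'] by linarith
  have h_le: "h (r n) \<le> hbar" for n
    unfolding hbar_def
    using hj[of "r n"] by (rule order_trans) (intro mult_left_mono power_mono j_le j0, simp)
  have W: "h (r n) + \<mu> (r n) \<le> W" for n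
    unfolding W_def \<mu>_def
    using l_pos[of "r n"] by (intro add_mono lms_mu_mono h_le j_le r_le l_le h0 j0 b) auto
  have W0: "0 < W" using W[of 0] h0[of "r 0"] \<mu>0[of "r 0"] by linarith
  \<comment> \<open>Replacing the step length by \<tau> and h + \<mu> by \<open>W\<close> leaves
    |g|^2 with a fixed positive coefficient, so a vanishing decrease of F forces g to
    vanish.\<close>
  have key: "c * \<tau> * ((1 - b) * (norm (g (r n)))\<^sup>2 / W) \<le> F (r n) - F (Suc (r n))" for n
  proof -
    have "c * \<tau> * ((1 - b) * (norm (g (r n)))\<^sup>2 / W)
        \<le> c * t (r n) * ((1 - b) * (norm (g (r n)))\<^sup>2 / (h (r n) + \<mu> (r n)))"
      using c b \<tau> t[of "r n"] t_lb[of "r n"] W[of n] W0 h0[of "r n"] \<mu>0[of "r n"]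
      by (intro mult_mono divide_left_mono) auto
    then show ?thesis using desc[of "r n"] by linarith
  qed
  obtain Finf where Finf: "F \<longlonglongrightarrow> Finf"
    using decseq_convergent[OF dec] F_ge by metis
  \<comment> \<open>The differences belong to consecutive iterates of the full sequence; the
    subsequence is taken only afterwards, so the second index is \<open>Suc (r n)\<close>.\<close>
  have "(\<lambda>k. F k - F (Suc k)) \<longlonglongrightarrow> Finf - Finf"
    by (intro tendsto_diff Finf LIMSEQ_Suc[OF Finf])
  from LIMSEQ_subseq_LIMSEQ[OF this r] have lim0: "(\<lambda>n. F (r n) - F (Suc (r n))) \<longlonglongrightarrow> 0"
    by (simp add: comp_def)
  have "isCont J xbar" using assms(2) by (simp add: continuous_on_eq_continuous_at)
  then have "(\<lambda>n. J (x (r n))) \<longlonglongrightarrow> J xbar" using xr by (rule isCont_tendsto_compose)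
  then have gr: "(\<lambda>n. g (r n)) \<longlonglongrightarrow> transpose (J xbar) *v R xbar"
    unfolding g_def using Rr by (rule tendsto_transpose_matrix_vector)
  have "(\<lambda>n. c * \<tau> * ((1 - b) * (norm (g (r n)))\<^sup>2 / W))
      \<longlonglongrightarrow> c * \<tau> * ((1 - b) * (norm (transpose (J xbar) *v R xbar))\<^sup>2 / W)"
    using W0 by (intro tendsto_intros gr) auto
  from LIMSEQ_le[OF this lim0] key
  have "c * \<tau> * ((1 - b) * (norm (transpose (J xbar) *v R xbar))\<^sup>2 / W) \<le> 0" by blast
  then show ?thesis using c b \<tau> W0
    by (simp add: mult_le_0_iff divide_le_0_iff)
qed simp

end
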